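(* Let $G$ be a finite connected graph (parallel edges and loops allowed). Then $G$ is double ear decomposable if and only if $\operatorname{tw}(G) \leq 2$ and $\deg_G(v) \in \{2,4\}$ for every node $v$ of $G$.
   Context: Graphs are finite, nonempty and connected, and may contain parallel edges and loops; a loop contributes $2$ to the degree of its endnode. A cycle may have length one (a single node with one loop) or length two (two nodes joined by two parallel edges). A path has pairwise distinct nodes. Simple subdivision: $G'$ is a simple subdivision of $G$ if it is obtained from $G$ by replacing one edge with endnodes $u$ and $w$ (possibly $u=w$) by a path $uvw$ through a new node $v$, i.e. by the two edges $uv$ and $vw$. Adding a double ear: Let $G$ contain a path $P = v_1 \cdots v_r$ ($r \geq 1$) with $\deg_G(v_i)=2$ for all $i=1,\dots,r$. Adding a double ear to $P$ means: (1) connect the first and the last node of $P$ by a new edge, and (2) duplicate each edge of $P$ (add one new parallel copy). If $r=1$ (path without edges), this means that a loop is added at $v_1$. A double ear decomposition of $G_k$ starting with $G_0$ is a finite sequence $(G_0,G_1,\dots,G_k)$ of graphs such that for each $i=1,\dots,k$, either $G_i$ is obtained from $G_{i-1}$ by adding a double ear (double ear step), or $G_i$ is a simple subdivision of $G_{i-1}$ (subdivision step). A graph $G$ is double ear decomposable if there is a double ear decomposition of $G$ starting with a cycle $G_0$. $\operatorname{tw}(G)$ is the usual treewidth: the minimum of $\max_{i\in I}|X_i|-1$ over all tree decompositions $(\{X_i : i\in I\}, T=(I,F))$ of $G$; parallel edges and loops do not affect it. *)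

theory Defs
  imports Main "HOL-Library.Multiset" "HOL-Library.Uprod"
begin

section \<open>Undirected multigraphs\<close>

text \<open>An edge is an unordered pair of nodes; parallel edges are recorded by their multiplicity,
  and \<open>Upair v v\<close> is a loop at \<open>v\<close>.\<close>

record 'a mgraph =
  nodes :: "'a set"
  edges :: "'a uprod multiset"

definition adjacent :: "'a mgraph \<Rightarrow> 'a \<Rightarrow> 'a \<Rightarrow> bool" where
  "adjacent G u v \<longleftrightarrow> Upair u v \<in># edges G"

definition is_graph :: "'a mgraph \<Rightarrow> bool" where
  "is_graph G \<longleftrightarrow>
     finite (nodes G) \<and> nodes G \<noteq> {} \<and>
     (\<forall>e \<in># edges G. set_uprod e \<subseteq> nodes G) \<and>
     (\<forall>u \<in> nodes G. \<forall>v \<in> nodes G. (adjacent G)\<^sup>*\<^sup>* u v)"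

text \<open>A loop is counted by both summands.\<close>

definition degree :: "'a mgraph \<Rightarrow> 'a \<Rightarrow> nat" where
  "degree G v = size {# e \<in># edges G. v \<in> set_uprod e #} + count (edges G) (Upair v v)"

definition path_edges :: "'a list \<Rightarrow> 'a uprod multiset" where
  "path_edges P = mset (map2 Upair P (tl P))"

text \<open>Since the nodes are pairwise distinct, so are the unordered pairs of consecutive nodes;
  hence every edge of a path is used with multiplicity one.\<close>

definition is_path :: "'a mgraph \<Rightarrow> 'a list \<Rightarrow> bool" where
  "is_path G P \<longleftrightarrow>
     P \<noteq> [] \<and> distinct P \<and> set P \<subseteq> nodes G \<and> path_edges P \<subseteq># edges G"

text \<open>For a list of length one the edges are a single loop, for length two they are two
  parallel edges.\<close>

definition is_cycle :: "'a mgraph \<Rightarrow> bool" where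
  "is_cycle C \<longleftrightarrow>
     (\<exists>vs. vs \<noteq> [] \<and> distinct vs \<and> nodes C = set vs \<and>
           edges C = mset (map2 Upair vs (rotate1 vs)))"

definition subgraph :: "'a mgraph \<Rightarrow> 'a mgraph \<Rightarrow> bool" where
  "subgraph H G \<longleftrightarrow> nodes H \<subseteq> nodes G \<and> edges H \<subseteq># edges G"

definition induced_subgraph :: "'a mgraph \<Rightarrow> 'a set \<Rightarrow> 'a mgraph" where
  "induced_subgraph G S =
     \<lparr>nodes = nodes G \<inter> S, edges = {# e \<in># edges G. set_uprod e \<subseteq> S #}\<rparr>"

definition is_tree :: "'a mgraph \<Rightarrow> bool" where
  "is_tree T \<longleftrightarrow> is_graph T \<and> \<not> (\<exists>C. subgraph C T \<and> is_cycle C)"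


section \<open>Double ear decompositions\<close>

definition simple_subdivision :: "'a mgraph \<Rightarrow> 'a mgraph \<Rightarrow> bool" where
  "simple_subdivision G G' \<longleftrightarrow>
     (\<exists>u w v. Upair u w \<in># edges G \<and> v \<notin> nodes G \<and>
        G' = \<lparr>nodes = insert v (nodes G),
              edges = edges G - {# Upair u w #} + {# Upair u v, Upair v w #}\<rparr>)"

definition add_double_ear :: "'a mgraph \<Rightarrow> 'a list \<Rightarrow> 'a mgraph" where
  "add_double_ear G P =
     \<lparr>nodes = nodes G, edges = edges G + {# Upair (hd P) (last P) #} + path_edges P\<rparr>"

definition double_ear_step :: "'a mgraph \<Rightarrow> 'a mgraph \<Rightarrow> bool" where
  "double_ear_step G G' \<longleftrightarrow>
     (\<exists>P. is_path G P \<and> (\<forall>v \<in> set P. degree G v = 2) \<and> G' = add_double_ear G P)"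

text \<open>The list \<open>Gs\<close> is \<open>G\<^sub>0, \<dots>, G\<^sub>k\<close> with \<open>k \<ge> 0\<close>. Both steps keep all existing nodes,
  so all members of the sequence live on subsets of the final node set and no
  identification up to isomorphism is needed.\<close>

definition double_ear_decomposition ::
    "'a mgraph list \<Rightarrow> 'a mgraph \<Rightarrow> 'a mgraph \<Rightarrow> bool" where
  "double_ear_decomposition Gs H G \<longleftrightarrow>
     Gs \<noteq> [] \<and> hd Gs = H \<and> last Gs = G \<and> (\<forall>K \<in> set Gs. is_graph K) \<and>
     successively (\<lambda>K K'. double_ear_step K K' \<or> simple_subdivision K K') Gs"

definition double_ear_decomposable :: "'a mgraph \<Rightarrow> bool" where
  "double_ear_decomposable G \<longleftrightarrow>
     (\<exists>Gs G0. is_cycle G0 \<and> double_ear_decomposition Gs G0 G)"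


section \<open>Treewidth\<close>

text \<open>Every finite tree is isomorphic to one on natural numbers, so taking \<open>nat\<close> as the type of
  tree nodes is no restriction.\<close>

definition tree_decomposition :: "'a mgraph \<Rightarrow> nat mgraph \<Rightarrow> (nat \<Rightarrow> 'a set) \<Rightarrow> bool" where
  "tree_decomposition G T X \<longleftrightarrow>
     is_tree T \<and>
     (\<Union>i \<in> nodes T. X i) = nodes G \<and>
     (\<forall>e \<in># edges G. \<exists>i \<in> nodes T. set_uprod e \<subseteq> X i) \<and>
     (\<forall>v \<in> nodes G. is_graph (induced_subgraph T {i. v \<in> X i}))"

text \<open>For a nonempty graph some bag is nonempty, so the subtraction does not truncate. The least
  element exists because a finite graph has the decomposition with a single bag.\<close>

definition decomposition_width :: "nat mgraph \<Rightarrow> (nat \<Rightarrow> 'a set) \<Rightarrow> nat" where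
  "decomposition_width T X = Max ((\<lambda>i. card (X i)) ` nodes T) - 1"

definition treewidth :: "'a mgraph \<Rightarrow> nat" where
  "treewidth G = (LEAST k. \<exists>T X. tree_decomposition G T X \<and> decomposition_width T X = k)"

end

theory Submission
  imports Defs
begin

text \<open>
  Both steps of a decomposition preserve width at most two: a subdivision attaches a new node to
  the two ends of an edge, and closing a path whose inner nodes have degree two can be undone by
  suppressing these nodes. Conversely, a node of degree two is suppressed, which reverses a
  subdivision. If all degrees are four, we look for a path that can be reversed as a double ear:
  one whose edges are all doubled and whose ends are joined by a further edge. Deleting that ear
  keeps the graph connected because one copy of the path remains. Such a path exists by induction
  on the number of nodes: some node \<open>v\<close> has at most two neighbours. If there is no loop and no
  triple edge at \<open>v\<close>, it is joined by double edges to two neighbours \<open>u\<close> and \<open>w\<close>; replace it by a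
  double edge \<open>uw\<close>, and reroute the path found there through \<open>v\<close>.
\<close>

section \<open>Incidence counts, paths and cycles\<close>

text \<open>The degree as a function of the edge multiset alone. It is additive in the multiset and
  also applies to the edges of a path, of an ear or of what is left after a deletion, where no graph
  is at hand.\<close>

definition incidence :: "'a uprod multiset \<Rightarrow> 'a \<Rightarrow> nat" where
  "incidence M v = size {# e \<in># M. v \<in> set_uprod e #} + count M (Upair v v)"

lemma degree_eq_incidence: "degree G v = incidence (edges G) v"
  by (simp add: degree_def incidence_def)

lemma incidence_empty [simp]: "incidence {#} v = 0"
  by (simp add: incidence_def)

lemma incidence_union [simp]: "incidence (M + N) v = incidence M v + incidence N v"
  by (simp add: incidence_def)

lemma incidence_add_Upair [simp]:
  "incidence (add_mset (Upair a b) M) v =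
     incidence M v + (if v = a then 1 else 0) + (if v = b then 1 else 0)"
  by (auto simp: incidence_def)

lemma incidence_mono: "M \<subseteq># N \<Longrightarrow> incidence M v \<le> incidence N v"
  by (metis incidence_union le_add1 subset_mset.add_diff_inverse)

lemma incidence_diff: "N \<subseteq># M \<Longrightarrow> incidence (M - N) v = incidence M v - incidence N v"
  by (metis add_diff_cancel_left' incidence_union subset_mset.add_diff_inverse)

lemma incidence_eq_0_iff: "incidence M v = 0 \<longleftrightarrow> (\<forall>e \<in># M. v \<notin> set_uprod e)"
  by (auto simp: incidence_def count_eq_zero_iff filter_mset_eq_conv)

lemma edge_at:
  assumes "v \<in> set_uprod e"
  obtains x where "e = Upair v x"
  using assms by (cases e) auto

lemma incidence_pos:
  assumes "incidence M v > 0"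
  obtains x N where "M = add_mset (Upair v x) N"
proof -
  obtain e where e: "e \<in># M" "v \<in> set_uprod e"
    using assms incidence_eq_0_iff[of M v] by auto
  then obtain x where "e = Upair v x" by (blast elim: edge_at)
  with e(1) show thesis using that[of x "M - {#e#}"] by simp
qed

text \<open>Serves twice: as the edge multiset of a cycle graph and as the set of edges that a
  double ear adds. For one node the closing edge is a loop, for two nodes it is a parallel copy of
  the path edge.\<close>

definition cycle_edges :: "'a list \<Rightarrow> 'a uprod multiset" where
  "cycle_edges P = add_mset (Upair (hd P) (last P)) (path_edges P)"

lemma path_edges_simps [simp]:
  "path_edges [] = {#}"
  "path_edges [x] = {#}"
  "path_edges (x # y # xs) = add_mset (Upair x y) (path_edges (y # xs))"
  by (simp_all add: path_edges_def)

lemma path_edges_split: "path_edges (xs @ p # ys) = path_edges (xs @ [p]) + path_edges (p # ys)"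
proof (induction xs)
  case (Cons x xs)
  then show ?case by (cases xs) auto
qed simp

lemma path_edges_snoc: "xs \<noteq> [] \<Longrightarrow> path_edges (xs @ [y]) = add_mset (Upair (last xs) y) (path_edges xs)"
  by (cases xs rule: rev_cases) (simp_all add: path_edges_split[of _ _ "[y]"])

lemma path_edges_subset: "e \<in># path_edges P \<Longrightarrow> set_uprod e \<subseteq> set P"
proof (induction P)
  case (Cons x P)
  then show ?case by (cases P) auto
qed simp

lemma path_edges_memE:
  assumes "e \<in># path_edges P"
  obtains xs p q ys where "P = xs @ p # q # ys" "e = Upair p q"
proof -
  have "\<exists>xs p q ys. P = xs @ p # q # ys \<and> e = Upair p q"
    using assms
  proof (induction P)
    case (Cons x P)
    show ?case
    proof (cases P)
      case (Cons y zs)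
      with Cons.prems consider "e = Upair x y" | "e \<in># path_edges P" by auto
      then show ?thesis
      proof cases
        case 1
        then show ?thesis using Cons by (metis append_Nil)
      next
        case 2
        then show ?thesis using Cons.IH by (metis append_Cons)
      qed
    qed (use Cons.prems in simp)
  qed simp
  with that show thesis by blast
qed

lemma mset_rotate1_eq_cycle_edges:
  assumes "vs \<noteq> []"
  shows "mset (map2 Upair vs (rotate1 vs)) = cycle_edges vs"
proof -
  \<comment> \<open>The closing node \<open>z\<close> is kept apart from the head \<open>x\<close>,
    since the head changes in the induction while the closing node does not.\<close>
  have "mset (map2 Upair (x # xs) (xs @ [z])) =
      add_mset (Upair z (last (x # xs))) (path_edges (x # xs))" for x z :: 'a and xs
    by (induction xs arbitrary: x) (auto simp: add_mset_commute)
  then show ?thesis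
    using assms by (cases vs) (auto simp: cycle_edges_def)
qed

lemma is_cycle_iff:
  "is_cycle C \<longleftrightarrow> (\<exists>vs. vs \<noteq> [] \<and> distinct vs \<and> nodes C = set vs \<and> edges C = cycle_edges vs)"
  unfolding is_cycle_def using mset_rotate1_eq_cycle_edges by metis

text \<open>Every occurrence of a node in the list meets two path edges, except that the first and
  the last occurrence each miss one. Adding the missing ones on the left avoids subtraction; for a
  list of length one both corrections fall on the same node.\<close>

lemma incidence_path_edges:
  "P \<noteq> [] \<Longrightarrow> incidence (path_edges P) v + (if v = hd P then 1 else 0) + (if v = last P then 1 else 0)
     = 2 * count (mset P) v"
proof (induction P)
  case (Cons x P)
  then show ?case by (cases P) auto
qed simp

lemma incidence_cycle_edges:
  assumes "P \<noteq> []" "distinct P"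
  shows "incidence (cycle_edges P) v = (if v \<in> set P then 2 else 0)"
proof -
  have "count (mset P) v = (if v \<in> set P then 1 else 0)"
    using assms(2) distinct_count_atmost_1[of P] by blast
  then show ?thesis
    using incidence_path_edges[OF assms(1), of v] by (auto simp: cycle_edges_def)
qed

text \<open>Elements of \<open>A\<close> have count zero in \<open>B\<close>, so \<open>N\<close>
  alone must supply them. This is how paths and cycles are seen to avoid newly added edges.\<close>

lemma subset_mset_union_disjoint:
  assumes "A \<subseteq># N + B" "\<And>x. x \<in># A \<Longrightarrow> x \<notin># B"
  shows "A \<subseteq># N"
proof (rule mset_subset_eqI)
  fix x show "count A x \<le> count N x"
  proof (cases "x \<in># A")
    case True
    then have "count B x = 0" using assms(2) by (simp add: not_in_iff)
    then show ?thesis using mset_subset_eq_count[OF assms(1), of x] by simp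
  qed (simp add: not_in_iff)
qed

lemma add_mset_subset_mset:
  assumes "A \<subseteq># E" "e \<in># E" "e \<notin># A"
  shows "add_mset e A \<subseteq># E"
proof -
  have "A \<subseteq># (E - {#e#}) + {#e#}" using assms by simp
  then have "A \<subseteq># E - {#e#}"
    by (rule subset_mset_union_disjoint) (use assms in auto)
  then show ?thesis using assms by (simp add: insert_subset_eq_iff)
qed

section \<open>Connectivity\<close>

lemma adjacent_commute: "adjacent G u v \<longleftrightarrow> adjacent G v u"
proof -
  have "Upair u v = Upair v u" by simp
  then show ?thesis by (simp only: adjacent_def)
qed

lemma reachable_commute: "(adjacent G)\<^sup>*\<^sup>* u v \<Longrightarrow> (adjacent G)\<^sup>*\<^sup>* v u"
proof -
  have "symp (adjacent G)" by (rule sympI) (simp add: adjacent_commute)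
  then show "(adjacent G)\<^sup>*\<^sup>* u v \<Longrightarrow> (adjacent G)\<^sup>*\<^sup>* v u"
    by (rule sympD[OF symp_rtranclp])
qed

text \<open>Walks of \<open>G\<close> are carried along \<open>f\<close>, edge by edge, to walks of
  \<open>H\<close>. When a node is deleted, \<open>f\<close> sends it to a neighbour; when only
  edges are deleted, \<open>f\<close> is the identity.\<close>

lemma is_graph_image:
  assumes "is_graph G" "finite (nodes H)" "\<And>e. e \<in># edges H \<Longrightarrow> set_uprod e \<subseteq> nodes H"
    and "nodes H \<noteq> {}" "nodes H \<subseteq> f ` nodes G"
    and step: "\<And>x y. adjacent G x y \<Longrightarrow> (adjacent H)\<^sup>*\<^sup>* (f x) (f y)"
  shows "is_graph H"
proof -
  have map: "(adjacent G)\<^sup>*\<^sup>* x y \<Longrightarrow> (adjacent H)\<^sup>*\<^sup>* (f x) (f y)" for x y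
    by (induction rule: rtranclp_induct) (auto intro: rtranclp_trans step)
  have "(adjacent H)\<^sup>*\<^sup>* u v" if "u \<in> nodes H" "v \<in> nodes H" for u v
  proof -
    from that assms(5) obtain x y where "x \<in> nodes G" "u = f x" "y \<in> nodes G" "v = f y"
      by blast
    with map show ?thesis using assms(1) by (simp add: is_graph_def)
  qed
  with assms(2-4) show ?thesis
    by (simp add: is_graph_def)
qed

lemma is_graph_ex_adjacent:
  assumes "is_graph G" "x \<in> nodes G" "nodes G \<noteq> {x}"
  obtains y where "y \<noteq> x" "adjacent G x y"
proof -
  obtain z where z: "z \<in> nodes G" "z \<noteq> x" using assms by blast
  then have "(adjacent G)\<^sup>*\<^sup>* x z" using assms unfolding is_graph_def by blast
  then have "z = x \<or> (\<exists>y. y \<noteq> x \<and> adjacent G x y)"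
    by (induction rule: rtranclp_induct) auto
  then show thesis using that z(2) by blast
qed

lemma reachable_path_edges:
  assumes "path_edges P \<subseteq># edges G" "P \<noteq> []"
  shows "(adjacent G)\<^sup>*\<^sup>* (hd P) (last P)"
  using assms
proof (induction P)
  case (Cons x P)
  show ?case
  proof (cases P)
    case (Cons y ys)
    with Cons.prems have sub: "add_mset (Upair x y) (path_edges P) \<subseteq># edges G" by simp
    have "adjacent G x y" "path_edges P \<subseteq># edges G"
      using mset_subset_eqD[OF sub] subset_mset.order_trans[OF _ sub, of "path_edges P"]
      by (auto simp: adjacent_def)
    moreover from this have "(adjacent G)\<^sup>*\<^sup>* y (last P)"
      using Cons.IH Cons by simp
    ultimately show ?thesis using Cons by (auto intro: converse_rtranclp_into_rtranclp)
  qed simp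
qed simp

section \<open>Trees\<close>

definition add_leaf :: "'a mgraph \<Rightarrow> 'a \<Rightarrow> 'a \<Rightarrow> 'a mgraph" where
  "add_leaf T j l = \<lparr>nodes = insert l (nodes T), edges = add_mset (Upair j l) (edges T)\<rparr>"

lemma is_graph_add_leaf:
  assumes "is_graph T" "j \<in> nodes T"
  shows "is_graph (add_leaf T j l)"
proof -
  let ?T = "add_leaf T j l"
  have "(adjacent T)\<^sup>*\<^sup>* x y \<Longrightarrow> (adjacent ?T)\<^sup>*\<^sup>* x y" for x y
    by (rule rtranclp_mono[THEN predicate2D]) (auto simp: adjacent_def add_leaf_def)
  moreover have "(adjacent ?T)\<^sup>*\<^sup>* j l"
    by (auto simp: adjacent_def add_leaf_def)
  ultimately have *: "(adjacent ?T)\<^sup>*\<^sup>* j x" if "x \<in> nodes ?T" for x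
    using assms that unfolding is_graph_def add_leaf_def by auto
  have "(adjacent ?T)\<^sup>*\<^sup>* x y" if "x \<in> nodes ?T" "y \<in> nodes ?T" for x y
    using *[OF that(1)] *[OF that(2)] by (meson reachable_commute rtranclp_trans)
  then show ?thesis
    using assms(1,2) by (auto simp: is_graph_def add_leaf_def)
qed

lemma not_incident: "is_graph G \<Longrightarrow> v \<notin> nodes G \<Longrightarrow> incidence (edges G) v = 0"
  by (auto simp: is_graph_def incidence_eq_0_iff)

text \<open>The new node has degree one, but every node of a cycle has degree two in it. So a cycle
  would avoid the new node and its edge and already lie in \<open>T\<close>.\<close>

lemma is_tree_add_leaf:
  assumes "is_tree T" "j \<in> nodes T" "l \<notin> nodes T"
  shows "is_tree (add_leaf T j l)"
  unfolding is_tree_def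
proof safe
  show "is_graph (add_leaf T j l)"
    using assms by (simp add: is_graph_add_leaf is_tree_def)
next
  fix C assume C: "subgraph C (add_leaf T j l)" "is_cycle C"
  then obtain vs where vs: "vs \<noteq> []" "distinct vs" "nodes C = set vs" "edges C = cycle_edges vs"
    by (auto simp: is_cycle_iff)
  have "incidence (edges T) l = 0"
    using assms not_incident is_tree_def by metis
  then have "incidence (edges (add_leaf T j l)) l = 1"
    using assms by (auto simp: add_leaf_def)
  then have "incidence (edges C) l \<le> 1"
    using C incidence_mono unfolding subgraph_def by metis
  then have l: "l \<notin> set vs" "incidence (edges C) l = 0"
    using incidence_cycle_edges[OF vs(1,2), of l] vs(4) by (auto split: if_splits)
  then have "Upair j l \<notin># edges C"
    by (auto simp: incidence_eq_0_iff)
  then have "subgraph C T"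
    using C l vs subset_mset_union_disjoint[of "edges C" "edges T" "{#Upair j l#}"]
    by (auto simp: subgraph_def add_leaf_def)
  with C assms show False by (auto simp: is_tree_def)
qed

lemma is_tree_singleton: "is_tree \<lparr>nodes = {r}, edges = {#}\<rparr>"
  by (auto simp: is_tree_def is_graph_def is_cycle_iff subgraph_def cycle_edges_def)

lemma is_graph_edges: "is_graph G \<Longrightarrow> Upair x y \<in># edges G \<Longrightarrow> x \<in> nodes G \<and> y \<in> nodes G"
  by (auto simp: is_graph_def)

lemma longest_path:
  assumes "is_graph G"
  obtains P where "is_path G P" "\<And>Q. is_path G Q \<Longrightarrow> length Q \<le> length P"
proof -
  have fin: "finite (nodes G)" and ne: "nodes G \<noteq> {}" using assms by (auto simp: is_graph_def)
  then obtain x where "x \<in> nodes G" by blast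
  then have x: "is_path G [x]" by (simp add: is_path_def)
  have bound: "length Q < Suc (card (nodes G))" if "is_path G Q" for Q
  proof -
    have "length Q = card (set Q)" using that by (simp add: is_path_def distinct_card)
    also have "\<dots> \<le> card (nodes G)" using that fin by (simp add: is_path_def card_mono)
    finally show ?thesis by simp
  qed
  have "\<exists>P. is_path G P \<and> (\<forall>Q. is_path G Q \<longrightarrow> length Q \<le> length P)"
    by (rule ex_has_greatest_nat[of "is_path G" "[x]" length "Suc (card (nodes G))"]) (use x bound in blast)+
  with that show thesis by blast
qed

text \<open>The first node \<open>p\<close> of a longest path is a leaf: a second edge at
  \<open>p\<close> would either leave the path and prolong it, or return to the path and close a
  cycle.\<close>

lemma is_tree_cases:
  assumes "is_tree T"
  obtains (single) r where "T = \<lparr>nodes = {r}, edges = {#}\<rparr>"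
  | (leaf) T' j l where "is_tree T'" "j \<in> nodes T'" "l \<notin> nodes T'" "T = add_leaf T' j l"
proof -
  have gT: "is_graph T" and acyc: "\<And>C. is_cycle C \<Longrightarrow> subgraph C T \<Longrightarrow> False"
    using assms by (auto simp: is_tree_def)
  have acyc: False if "vs \<noteq> []" "distinct vs" "set vs \<subseteq> nodes T" "cycle_edges vs \<subseteq># edges T" for vs
    by (rule acyc[of "\<lparr>nodes = set vs, edges = cycle_edges vs\<rparr>"])
       (use that in \<open>auto simp: is_cycle_iff subgraph_def\<close>)
  have loopless: "Upair x x \<notin># edges T" for x
    using acyc[of "[x]"] is_graph_edges[OF gT, of x x] by (auto simp: cycle_edges_def)
  show thesis
  proof (cases "\<exists>r. nodes T = {r}")
    case True
    then obtain r where r: "nodes T = {r}" by blast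
    have "e \<notin># edges T" for e
    proof (cases e)
      case (Upair a b)
      then show ?thesis using loopless is_graph_edges[OF gT, of a b] r by auto
    qed
    then have "edges T = {#}" by blast
    with r show thesis by (intro single[of r]) simp
  next
    case False
    obtain P where P: "is_path T P" and max: "\<And>Q. is_path T Q \<Longrightarrow> length Q \<le> length P"
      using longest_path[OF gT] by blast
    then obtain p P' where Pp: "P = p # P'" by (cases P) (auto simp: is_path_def)
    have p: "p \<in> nodes T" using P Pp by (auto simp: is_path_def)
    have "P' \<noteq> []"
    proof
      assume "P' = []"
      obtain q where "q \<noteq> p" "adjacent T p q"
        using is_graph_ex_adjacent[OF gT p] False by blast
      then have "is_path T [p, q]"
        using is_graph_edges[OF gT] by (auto simp: is_path_def adjacent_def)
      from max[OF this] Pp \<open>P' = []\<close> show False by simp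
    qed
    then obtain q R where P': "P' = q # R" by (cases P') auto
    then have "Upair p q \<in># edges T"
      using P Pp by (auto simp: is_path_def dest: mset_subset_eqD)
    then obtain E where E: "edges T = add_mset (Upair p q) E" by (metis insert_DiffM)
    have sub: "path_edges P' \<subseteq># E" using P Pp P' E by (simp add: is_path_def)
    \<comment> \<open>Only one copy of \<open>Upair p q\<close> is missing from \<open>E\<close>, so
      a parallel edge is excluded as well: it falls under the second case below with
      \<open>x = q\<close> and \<open>A = []\<close>, giving a cycle of length two.\<close>
    have p_notin: "p \<notin> set_uprod e" if e: "e \<in># E" for e
    proof
      assume "p \<in> set_uprod e"
      then obtain x where x: "e = Upair p x" by (rule edge_at)
      with e E have xT: "x \<in> nodes T" "x \<noteq> p"
        using is_graph_edges[OF gT, of p x] loopless[of p] by auto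
      have pP': "p \<notin> set P'" using P Pp by (auto simp: is_path_def)
      then have e_notin: "e \<notin># path_edges P'" using path_edges_subset[of e P'] x by auto
      show False
      proof (cases "x \<in> set P'")
        case False
        have "path_edges (x # P) \<subseteq># edges T"
        proof -
          have "e \<notin># path_edges P"
            using path_edges_subset[of e P] False x xT Pp by auto
          then have "add_mset e (path_edges P) \<subseteq># edges T"
            using P E e by (intro add_mset_subset_mset) (auto simp: is_path_def)
          moreover have "Upair x p = e" using x by simp
          ultimately show ?thesis using Pp by simp
        qed
        then have "is_path T (x # P)"
          using P xT False Pp by (auto simp: is_path_def)
        from max[OF this] show False by simp
      next
        case True
        then obtain A B where AB: "P' = A @ x # B" by (meson split_list)
        have "path_edges (A @ [x]) \<subseteq># path_edges P'"
          using path_edges_split[of A x B] AB by simp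
        then have "path_edges (A @ [x]) \<subseteq># E" using sub by (rule subset_mset.order_trans)
        moreover have "e \<notin># path_edges (A @ [x])"
          using path_edges_subset[of e "A @ [x]"] pP' x AB by auto
        ultimately have "add_mset e (path_edges (A @ [x])) \<subseteq># E"
          using e by (intro add_mset_subset_mset)
        moreover have "path_edges (p # A @ [x]) = add_mset (Upair p q) (path_edges (A @ [x]))"
          using AB P' by (cases A) auto
        ultimately have "cycle_edges (p # A @ [x]) \<subseteq># edges T"
          using E x by (auto simp: cycle_edges_def)
        moreover have "distinct (p # A @ [x])" "set (p # A @ [x]) \<subseteq> nodes T"
          using P Pp AB by (auto simp: is_path_def)
        ultimately show False using acyc by blast
      qed
    qed
    define T' where "T' = \<lparr>nodes = nodes T - {p}, edges = E\<rparr>"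
    have q: "q \<in> nodes T" "q \<noteq> p" using P Pp P' by (auto simp: is_path_def)
    have T: "T = add_leaf T' q p"
      using E p by (cases T) (auto simp: T'_def add_leaf_def)
    have "is_graph T'"
    proof (rule is_graph_image[OF gT, where f = "\<lambda>x. if x = p then q else x"])
      fix e assume e: "e \<in># edges T'"
      then have "set_uprod e \<subseteq> nodes T" using gT E by (simp add: is_graph_def T'_def)
      with e p_notin show "set_uprod e \<subseteq> nodes T'" by (auto simp: T'_def)
    next
      fix x y assume "adjacent T x y"
      then consider "Upair x y = Upair p q" | "Upair x y \<in># E" by (auto simp: adjacent_def E)
      then show "(adjacent T')\<^sup>*\<^sup>* (if x = p then q else x) (if y = p then q else y)"
      proof cases
        case 2
        with p_notin have "x \<noteq> p" "y \<noteq> p" by fastforce+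
        with 2 show ?thesis by (auto simp: T'_def adjacent_def)
      qed auto
    qed (use gT q in \<open>auto simp: T'_def is_graph_def\<close>)
    then have "is_tree T'"
      unfolding is_tree_def
    proof safe
      fix C assume "subgraph C T'" "is_cycle C"
      then obtain vs where "vs \<noteq> []" "distinct vs" "set vs \<subseteq> nodes T'" "cycle_edges vs \<subseteq># edges T'"
        by (auto simp: is_cycle_iff subgraph_def)
      moreover have "nodes T' \<subseteq> nodes T" "edges T' \<subseteq># edges T" by (auto simp: T'_def E)
      ultimately show False
        by (meson acyc subset_trans subset_mset.order_trans)
    qed
    with T q p show thesis by (intro leaf[of T' q p]) (auto simp: T'_def)
  qed
qed

lemma is_tree_induct [consumes 1, case_names single leaf]:
  assumes "is_tree T"
    and "\<And>r. P \<lparr>nodes = {r}, edges = {#}\<rparr>"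
    and "\<And>T j l. is_tree T \<Longrightarrow> j \<in> nodes T \<Longrightarrow> l \<notin> nodes T \<Longrightarrow> P T \<Longrightarrow> P (add_leaf T j l)"
  shows "P T"
  using assms(1)
proof (induction "card (nodes T)" arbitrary: T rule: less_induct)
  case less
  from less.prems show ?case
  proof (cases rule: is_tree_cases)
    case (single r)
    then show ?thesis using assms(2) by simp
  next
    case (leaf T' j l)
    then have "card (nodes T') < card (nodes T)"
      by (auto simp: add_leaf_def is_tree_def is_graph_def)
    with leaf less.hyps assms(3) show ?thesis by blast
  qed
qed

section \<open>Tree decompositions of bounded width\<close>

text \<open>A tree decomposition with the width bound imposed bag by bag, stated for a node set and
  an edge set because multiplicities do not matter. Finiteness is demanded since \<open>card\<close>
  of an infinite set is 0. That \<open>T\<close> is a tree is left outside, so that inductions on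
  trees can carry \<open>bags\<close> along.\<close>

definition bags :: "nat \<Rightarrow> nat mgraph \<Rightarrow> (nat \<Rightarrow> 'a set) \<Rightarrow> 'a set \<Rightarrow> 'a uprod set \<Rightarrow> bool" where
  "bags k T X V E \<longleftrightarrow>
     (\<Union>i \<in> nodes T. X i) = V \<and>
     (\<forall>e \<in> E. \<exists>i \<in> nodes T. set_uprod e \<subseteq> X i) \<and>
     (\<forall>v \<in> V. is_graph (induced_subgraph T {i. v \<in> X i})) \<and>
     (\<forall>i \<in> nodes T. finite (X i) \<and> card (X i) \<le> Suc k)"

definition width_le :: "nat \<Rightarrow> 'a set \<Rightarrow> 'a uprod set \<Rightarrow> bool" where
  "width_le k V E \<longleftrightarrow> (\<exists>T X. is_tree T \<and> bags k T X V E)"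

lemma width_le_mono:
  assumes "width_le k V E" "E' \<subseteq> E"
  shows "width_le k V E'"
proof -
  obtain T X where T: "is_tree T" and bags: "bags k T X V E"
    using assms by (auto simp: width_le_def)
  from bags have "\<forall>e \<in> E. \<exists>i \<in> nodes T. set_uprod e \<subseteq> X i" by (simp add: bags_def)
  with assms(2) have "\<forall>e \<in> E'. \<exists>i \<in> nodes T. set_uprod e \<subseteq> X i" by fast
  with bags have "bags k T X V E'" by (simp add: bags_def)
  with T show ?thesis by (auto simp: width_le_def)
qed

lemma bags_coverE:
  assumes "bags k T X V E" "e \<in> E"
  obtains i where "i \<in> nodes T" "set_uprod e \<subseteq> X i"
  using assms by (auto simp: bags_def)

lemma bagsD:
  assumes "bags k T X V E"
  shows "(\<Union>i \<in> nodes T. X i) = V"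
    and "v \<in> V \<Longrightarrow> is_graph (induced_subgraph T {i. v \<in> X i})"
    and "i \<in> nodes T \<Longrightarrow> X i \<subseteq> V"
    and "i \<in> nodes T \<Longrightarrow> finite (X i)"
    and "i \<in> nodes T \<Longrightarrow> card (X i) \<le> Suc k"
proof -
  show V: "(\<Union>i \<in> nodes T. X i) = V" using assms by (simp add: bags_def)
  then show "i \<in> nodes T \<Longrightarrow> X i \<subseteq> V" by blast
qed (use assms in \<open>simp_all add: bags_def\<close>)

lemma bags_edgeE:
  assumes "bags k T X V E" "Upair a b \<in> E"
  obtains i where "i \<in> nodes T" "a \<in> X i" "b \<in> X i"
  by (rule bags_coverE[OF assms]) (auto intro: that)

section \<open>Subtrees when a leaf is added or removed, and unions of subtrees\<close>

lemma nodes_induced [simp]: "nodes (induced_subgraph T S) = nodes T \<inter> S"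
  by (simp add: induced_subgraph_def)

lemma adjacent_induced [simp]:
  "adjacent (induced_subgraph T S) i j \<longleftrightarrow> adjacent T i j \<and> i \<in> S \<and> j \<in> S"
  by (auto simp: induced_subgraph_def adjacent_def)

lemma induced_subgraph_edges: "e \<in># edges (induced_subgraph T S) \<longleftrightarrow> e \<in># edges T \<and> set_uprod e \<subseteq> S"
  by (simp add: induced_subgraph_def)

lemma nodes_add_leaf [simp]: "nodes (add_leaf T j l) = insert l (nodes T)"
  by (simp add: add_leaf_def)

lemma adjacent_add_leaf [simp]:
  "adjacent (add_leaf T j l) x y \<longleftrightarrow> adjacent T x y \<or> x = j \<and> y = l \<or> x = l \<and> y = j"
  by (auto simp: add_leaf_def adjacent_def)

lemma adjacent_nodes: "is_graph T \<Longrightarrow> adjacent T x y \<Longrightarrow> x \<in> nodes T \<and> y \<in> nodes T"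
  by (simp add: adjacent_def is_graph_edges)

lemma induced_add_leaf:
  assumes "is_graph T" "j \<in> nodes T" "l \<notin> nodes T"
  shows "j \<in> S \<Longrightarrow> l \<in> S \<Longrightarrow> induced_subgraph (add_leaf T j l) S = add_leaf (induced_subgraph T S) j l"
    and "l \<notin> S \<Longrightarrow> induced_subgraph (add_leaf T j l) S = induced_subgraph T S"
  using assms by (auto simp: induced_subgraph_def add_leaf_def)

lemma induced_subgraph_cong:
  assumes "is_graph T" "\<And>i. i \<in> nodes T \<Longrightarrow> i \<in> S \<longleftrightarrow> i \<in> S'"
  shows "induced_subgraph T S = induced_subgraph T S'"
  using assms unfolding induced_subgraph_def is_graph_def
  by (auto intro!: filter_mset_cong) blast+

text \<open>The leaf \<open>l\<close> is redirected to its only neighbour \<open>j\<close>. The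
  second assumption on \<open>S\<close> keeps the image inside \<open>S\<close> and prevents it from
  becoming empty.\<close>

lemma is_graph_induced_remove_leaf:
  assumes T: "is_graph T" "j \<in> nodes T" "l \<notin> nodes T"
    and S: "is_graph (induced_subgraph (add_leaf T j l) S)" "l \<in> S \<Longrightarrow> j \<in> S"
  shows "is_graph (induced_subgraph T S)"
proof (rule is_graph_image[OF S(1), where f = "\<lambda>x. if x = l then j else x"])
  show "finite (nodes (induced_subgraph T S))" using T by (simp add: is_graph_def)
  show "set_uprod e \<subseteq> nodes (induced_subgraph T S)" if "e \<in># edges (induced_subgraph T S)" for e
    using that T by (auto simp: induced_subgraph_edges is_graph_def)
  have "nodes (induced_subgraph (add_leaf T j l) S) \<noteq> {}" using S(1) by (simp add: is_graph_def)
  then show "nodes (induced_subgraph T S) \<noteq> {}" using S(2) T(2) by auto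
  show "nodes (induced_subgraph T S)
      \<subseteq> (\<lambda>x. if x = l then j else x) ` nodes (induced_subgraph (add_leaf T j l) S)"
    using T(3) by (auto simp: image_iff)
next
  fix x y assume "adjacent (induced_subgraph (add_leaf T j l) S) x y"
  then show "(adjacent (induced_subgraph T S))\<^sup>*\<^sup>* (if x = l then j else x) (if y = l then j else y)"
    using T adjacent_nodes[OF T(1), of x y] by auto
qed

text \<open>Every node of either part is reached through the common node \<open>i\<close>. Needed
  when two nodes of a graph are merged, where the subtrees of their bags unite.\<close>

lemma is_graph_induced_Un:
  assumes T: "is_graph T" and A: "is_graph (induced_subgraph T A)" and B: "is_graph (induced_subgraph T B)"
    and i: "i \<in> nodes T" "i \<in> A" "i \<in> B"
  shows "is_graph (induced_subgraph T (A \<union> B))"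
proof -
  let ?U = "induced_subgraph T (A \<union> B)"
  have mono: "(adjacent (induced_subgraph T S))\<^sup>*\<^sup>* x y \<Longrightarrow> (adjacent ?U)\<^sup>*\<^sup>* x y"
    if "S \<subseteq> A \<union> B" for S x y
    by (rule rtranclp_mono[THEN predicate2D]) (use that in auto)
  have reach: "(adjacent ?U)\<^sup>*\<^sup>* i x" if "x \<in> nodes ?U" for x
  proof (cases "x \<in> A")
    case True
    with that i A show ?thesis by (intro mono[of A]) (auto simp: is_graph_def)
  next
    case False
    with that i B show ?thesis by (intro mono[of B]) (auto simp: is_graph_def)
  qed
  have "(adjacent ?U)\<^sup>*\<^sup>* x y" if "x \<in> nodes ?U" "y \<in> nodes ?U" for x y
    using reachable_commute[OF reach[OF that(1)]] reach[OF that(2)] by (rule rtranclp_trans)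
  moreover have "set_uprod e \<subseteq> nodes ?U" if "e \<in># edges ?U" for e
    using that T by (auto simp: induced_subgraph_edges is_graph_def)
  moreover have "finite (nodes ?U)" "nodes ?U \<noteq> {}" using T i by (auto simp: is_graph_def)
  ultimately show ?thesis by (simp add: is_graph_def)
qed

lemma is_graph_singleton [simp]: "is_graph \<lparr>nodes = {r}, edges = {#}\<rparr>"
  using is_tree_singleton[of r] by (simp add: is_tree_def)

lemma width_le_single_bag:
  assumes "finite V" "card V \<le> Suc k" "\<And>e. e \<in> E \<Longrightarrow> set_uprod e \<subseteq> V"
  shows "width_le k V E"
proof -
  have "is_graph (induced_subgraph \<lparr>nodes = {0::nat}, edges = {#}\<rparr> {i. True})"
    by (simp add: induced_subgraph_def)
  then have "bags k \<lparr>nodes = {0}, edges = {#}\<rparr> (\<lambda>_. V) V E"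
    using assms by (auto simp: bags_def)
  then show ?thesis using is_tree_singleton[of 0] unfolding width_le_def by blast
qed

lemma bags_iff_tree_decomposition:
  assumes "is_graph G" "is_tree T"
  shows "bags k T X (nodes G) (set_mset (edges G)) \<longleftrightarrow>
    tree_decomposition G T X \<and> decomposition_width T X \<le> k"
proof (cases "tree_decomposition G T X")
  case True
  then have X: "(\<Union>i \<in> nodes T. X i) = nodes G" by (simp add: tree_decomposition_def)
  have T: "finite (nodes T)" "nodes T \<noteq> {}"
    using assms(2) by (simp_all add: is_tree_def is_graph_def)
  have "finite (X i)" if "i \<in> nodes T" for i
  proof -
    from that X have "X i \<subseteq> nodes G" by blast
    then show ?thesis using assms(1) by (simp add: is_graph_def finite_subset)
  qed
  moreover have "decomposition_width T X \<le> k \<longleftrightarrow> (\<forall>i \<in> nodes T. card (X i) \<le> Suc k)"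
  proof -
    \<comment> \<open>Truncation is harmless here: for natural numbers \<open>n - 1 \<le> k\<close>
      and \<open>n \<le> Suc k\<close> are equivalent even if \<open>n = 0\<close>.\<close>
    have "decomposition_width T X \<le> k \<longleftrightarrow> Max ((\<lambda>i. card (X i)) ` nodes T) \<le> Suc k"
      unfolding decomposition_width_def by linarith
    then show ?thesis using T by simp
  qed
  ultimately show ?thesis using True by (simp add: bags_def tree_decomposition_def)
next
  case False
  have "bags k T X (nodes G) (set_mset (edges G)) \<Longrightarrow> tree_decomposition G T X"
    using assms(2) by (simp add: bags_def tree_decomposition_def)
  with False show ?thesis by blast
qed

lemma treewidth_le_iff:
  assumes "is_graph G"
  shows "treewidth G \<le> k \<longleftrightarrow> width_le k (nodes G) (set_mset (edges G))"
proof -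
  have fin: "finite (nodes G)" using assms by (simp add: is_graph_def)
  let ?P = "\<lambda>w. \<exists>T X. tree_decomposition G T X \<and> decomposition_width T X = w"
  \<comment> \<open>The single bag with all nodes shows that some decomposition exists, so the
    \<open>LEAST\<close> in \<open>treewidth\<close> is attained. The bound is generous by
    one.\<close>
  have "width_le (card (nodes G)) (nodes G) (set_mset (edges G))"
    using assms fin by (intro width_le_single_bag) (auto simp: is_graph_def)
  then obtain T X where "bags (card (nodes G)) T X (nodes G) (set_mset (edges G))" "is_tree T"
    by (auto simp: width_le_def)
  then have "tree_decomposition G T X" by (simp add: bags_iff_tree_decomposition[OF assms])
  then have "\<exists>w. ?P w" by blast
  then have P: "?P (treewidth G)" unfolding treewidth_def by (rule LeastI_ex)
  have le: "treewidth G \<le> w" if "?P w" for w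
    unfolding treewidth_def using that by (rule Least_le)
  show ?thesis
  proof
    assume "treewidth G \<le> k"
    moreover obtain T X where "tree_decomposition G T X" "decomposition_width T X = treewidth G"
      using P by blast
    moreover from this have "is_tree T" by (simp add: tree_decomposition_def)
    ultimately have "bags k T X (nodes G) (set_mset (edges G))"
      by (simp add: bags_iff_tree_decomposition[OF assms])
    with \<open>is_tree T\<close> show "width_le k (nodes G) (set_mset (edges G))" by (auto simp: width_le_def)
  next
    assume "width_le k (nodes G) (set_mset (edges G))"
    then obtain T X where "bags k T X (nodes G) (set_mset (edges G))" "is_tree T"
      by (auto simp: width_le_def)
    then have "tree_decomposition G T X" and w: "decomposition_width T X \<le> k"
      by (simp_all add: bags_iff_tree_decomposition[OF assms])
    then have "treewidth G \<le> decomposition_width T X" by (intro le) blast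
    with w show "treewidth G \<le> k" by simp
  qed
qed

section \<open>Low-degree nodes, contraction and attachment under bounded width\<close>

text \<open>If a leaf bag lies inside the adjacent bag, the leaf is dropped. Otherwise it has a node
  occurring in no other bag, and all neighbours of that node are among the at most \<open>k\<close>
  other members of the bag.\<close>

lemma width_le_ex_low_degree:
  assumes "width_le k V E" "V \<noteq> {}"
  shows "\<exists>v \<in> V. finite {u. u \<noteq> v \<and> Upair v u \<in> E} \<and> card {u. u \<noteq> v \<and> Upair v u \<in> E} \<le> k"
proof -
  \<comment> \<open>The concluding argument for a node private to one bag, shared by the one-node
    tree and the leaf case.\<close>
  have low: ?thesis if v: "v \<in> X l" and l: "l \<in> nodes T" "\<And>i. i \<in> nodes T \<Longrightarrow> v \<in> X i \<Longrightarrow> i = l"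
    and bags: "bags k T X V E" for T :: "nat mgraph" and X l v
  proof -
    have sub: "{u. u \<noteq> v \<and> Upair v u \<in> E} \<subseteq> X l - {v}"
    proof safe
      fix u assume "Upair v u \<in> E"
      then obtain i where "i \<in> nodes T" "v \<in> X i" "u \<in> X i" by (rule bags_edgeE[OF bags])
      with l(2) show "u \<in> X l" by metis
    qed
    have X: "X l \<subseteq> V" "finite (X l)" "card (X l) \<le> Suc k"
      using bagsD(3-5)[OF bags l(1)] by auto
    then have fin: "finite (X l - {v})" and "card (X l - {v}) \<le> k" and "v \<in> V" using v by auto
    then show ?thesis
      using card_mono[OF fin sub] finite_subset[OF sub fin] by fastforce
  qed
  obtain T X where "is_tree T" "bags k T X V E"
    using assms by (auto simp: width_le_def)
  then show ?thesis
  proof (induction rule: is_tree_induct)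
    case (single r)
    then obtain v where "v \<in> X r" using bagsD(1)[OF single] assms(2) by auto
    then show ?case using low[OF _ _ _ single] by simp
  next
    case (leaf T j l)
    let ?T = "add_leaf T j l"
    have T: "is_graph T" using leaf by (simp add: is_tree_def)
    have conn: "is_graph (induced_subgraph ?T {i. v \<in> X i})" if "v \<in> V" for v
      using bagsD(2)[OF leaf.prems that] .
    show ?case
    proof (cases "X l \<subseteq> X j")
      case True
      have "is_graph (induced_subgraph T {i. v \<in> X i})" if "v \<in> V" for v
        using True by (intro is_graph_induced_remove_leaf[OF T leaf(2,3) conn[OF that]]) auto
      moreover have "(\<Union>i \<in> nodes T. X i) = V"
        using bagsD(1)[OF leaf.prems] leaf(2) True by auto
      moreover have "\<exists>i \<in> nodes T. set_uprod e \<subseteq> X i" if e: "e \<in> E" for e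
      proof -
        obtain i where "i \<in> insert l (nodes T)" "set_uprod e \<subseteq> X i"
          using bags_coverE[OF leaf.prems e] unfolding nodes_add_leaf by blast
        then show ?thesis using True leaf(2) by (cases "i = l") auto
      qed
      ultimately have "bags k T X V E"
        using leaf.prems by (simp add: bags_def)
      then show ?thesis by (rule leaf.IH)
    next
      case False
      then obtain v where v: "v \<in> X l" "v \<notin> X j" by blast
      then have "v \<in> V" using bagsD(3)[OF leaf.prems, of l] by auto
      let ?S = "induced_subgraph ?T {i. v \<in> X i}"
      \<comment> \<open>The bags containing \<open>v\<close> form a connected subtree. Its node
        \<open>l\<close> has no neighbour there, as \<open>j\<close> is excluded, so the subtree is
        \<open>l\<close> alone.\<close>
      have "\<not> adjacent ?S l y" for y
        using v adjacent_nodes[OF T, of l y] leaf(3) by auto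
      then have "nodes ?S = {l}"
        using is_graph_ex_adjacent[OF conn[OF \<open>v \<in> V\<close>], of l] v by auto
      then show ?thesis using v by (intro low[OF _ _ _ leaf.prems, of v l]) auto
    qed
  qed
qed

text \<open>In every bag \<open>v\<close> is replaced by \<open>u\<close>. The bags of the merged
  node are those of \<open>u\<close> together with those of \<open>v\<close>; these two subtrees
  meet in a bag covering the contracted edge.\<close>

lemma width_le_contract:
  assumes "width_le k V E" "Upair u v \<in> E" "u \<noteq> v"
  shows "width_le k (V - {v}) ({e \<in> E. v \<notin> set_uprod e} \<union> {Upair u x |x. Upair v x \<in> E \<and> x \<noteq> v})"
proof -
  obtain T X where T: "is_tree T" and bags: "bags k T X V E"
    using assms by (auto simp: width_le_def)
  have gT: "is_graph T" using T by (simp add: is_tree_def)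
  define X' where "X' i = (if v \<in> X i then insert u (X i - {v}) else X i)" for i
  obtain i where i: "i \<in> nodes T" "u \<in> X i" "v \<in> X i"
    using assms(2) by (auto elim: bags_edgeE[OF bags])
  then have V: "u \<in> V" "v \<in> V" using bagsD(3)[OF bags] by auto
  have "is_graph (induced_subgraph T {i. y \<in> X' i})" if y: "y \<in> V - {v}" for y
  proof (cases "y = u")
    case True
    then have "{i. y \<in> X' i} = {i. u \<in> X i} \<union> {i. v \<in> X i}"
      using assms(3) by (auto simp: X'_def)
    moreover have "is_graph (induced_subgraph T ({i. u \<in> X i} \<union> {i. v \<in> X i}))"
      using V i by (intro is_graph_induced_Un[OF gT bagsD(2)[OF bags] bagsD(2)[OF bags]]) auto
    ultimately show ?thesis by simp
  next
    case False
    with y have "{i. y \<in> X' i} = {i. y \<in> X i}" by (auto simp: X'_def)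
    with y show ?thesis using bagsD(2)[OF bags] by simp
  qed
  moreover have "(\<Union>i \<in> nodes T. X' i) = V - {v}"
  proof -
    have "(\<Union>i \<in> nodes T. X' i) \<subseteq> V - {v}"
      using bagsD(3)[OF bags] V assms(3) by (force simp: X'_def split: if_splits)
    moreover have "V - {v} \<subseteq> (\<Union>i \<in> nodes T. X' i)"
      unfolding bagsD(1)[OF bags, symmetric] by (auto simp: X'_def)
    ultimately show ?thesis by blast
  qed
  moreover have "\<exists>i \<in> nodes T. set_uprod e \<subseteq> X' i"
    if e: "e \<in> {e \<in> E. v \<notin> set_uprod e} \<union> {Upair u x |x. Upair v x \<in> E \<and> x \<noteq> v}" for e
  proof -
    from e consider "e \<in> E" "v \<notin> set_uprod e" | x where "e = Upair u x" "Upair v x \<in> E" "x \<noteq> v"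
      by blast
    then show ?thesis
    proof cases
      case 1
      then obtain i where "i \<in> nodes T" "set_uprod e \<subseteq> X i" by (auto elim: bags_coverE[OF bags])
      with 1 show ?thesis by (intro bexI[of _ i]) (auto simp: X'_def)
    next
      case 2
      then obtain i where "i \<in> nodes T" "v \<in> X i" "x \<in> X i"
        by (auto elim: bags_edgeE[OF bags])
      with 2 show ?thesis by (intro bexI[of _ i]) (auto simp: X'_def)
    qed
  qed
  moreover have "finite (X' i) \<and> card (X' i) \<le> Suc k" if "i \<in> nodes T" for i
  proof -
    have *: "finite (X i)" "card (X i) \<le> Suc k" using bagsD(4,5)[OF bags that] by auto
    \<comment> \<open>The removal of \<open>v\<close> makes room for \<open>u\<close>.\<close>
    have "card (insert u (X i - {v})) \<le> card (X i)" if "v \<in> X i"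
      using * that card_insert_le_m1[of "card (X i)" "X i - {v}" u]
      by (auto simp: card_gt_0_iff)
    with * show ?thesis by (auto simp: X'_def)
  qed
  ultimately have "bags k T X' (V - {v}) ({e \<in> E. v \<notin> set_uprod e} \<union> {Upair u x |x. Upair v x \<in> E \<and> x \<noteq> v})"
    unfolding bags_def by blast
  with T show ?thesis by (auto simp: width_le_def)
qed

text \<open>A leaf with bag \<open>{u, v, w}\<close> is hung onto a tree node whose bag covers the
  edge \<open>Upair u w\<close>; \<open>k \<ge> 2\<close> admits three members. The old edge is
  kept, and \<open>u = w\<close> is allowed.\<close>

lemma width_le_attach:
  assumes "width_le k V E" "Upair u w \<in> E" "v \<notin> V" "k \<ge> 2"
  shows "width_le k (insert v V) (insert (Upair u v) (insert (Upair v w) E))"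
proof -
  obtain T X where T: "is_tree T" and bags: "bags k T X V E"
    using assms by (auto simp: width_le_def)
  have gT: "is_graph T" using T by (simp add: is_tree_def)
  obtain j where j: "j \<in> nodes T" "u \<in> X j" "w \<in> X j"
    using assms(2) by (auto elim: bags_edgeE[OF bags])
  obtain l where l: "l \<notin> nodes T"
    using gT ex_new_if_finite[OF infinite_UNIV_nat, of "nodes T"] by (auto simp: is_graph_def)
  define X' where "X' = X(l := {u, v, w})"
  have X': "X' i = X i" if "i \<in> nodes T" for i using that l by (auto simp: X'_def)
  have Xl: "X' l = {u, v, w}" by (simp add: X'_def)
  let ?T = "add_leaf T j l"
  have "is_graph (induced_subgraph ?T {i. y \<in> X' i})" if y: "y \<in> insert v V" for y
  proof (cases "y = v")
    case True
    have v_notin: "v \<notin> X i" if "i \<in> nodes T" for i using bagsD(3)[OF bags that] assms(3) by auto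
    then have "nodes ?T \<inter> {i. y \<in> X' i} = {l}" using True X' Xl by auto
    moreover have "edges (induced_subgraph ?T {i. y \<in> X' i}) = {#}"
    proof -
      \<comment> \<open>Bags at indices outside the tree are arbitrary. Hence the argument uses that
        every edge of the enlarged tree has an end in \<open>nodes T\<close>, where no bag contains
        \<open>v\<close>.\<close>
      have "\<not> set_uprod e \<subseteq> {i. y \<in> X' i}" if e: "e \<in># edges ?T" for e
      proof (cases e)
        case (Upair a b)
        then have "a \<in> nodes T \<or> b \<in> nodes T"
          using e j is_graph_edges[OF gT, of a b] by (auto simp: add_leaf_def)
        then show ?thesis using Upair True X' v_notin by auto
      qed
      then show ?thesis by (auto simp: induced_subgraph_def)
    qed
    ultimately have "induced_subgraph ?T {i. y \<in> X' i} = \<lparr>nodes = {l}, edges = {#}\<rparr>"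
      by (simp add: induced_subgraph_def)
    then show ?thesis by simp
  next
    case False
    with y have "is_graph (induced_subgraph T {i. y \<in> X i})" using bagsD(2)[OF bags] by simp
    moreover have "induced_subgraph T {i. y \<in> X i} = induced_subgraph T {i. y \<in> X' i}"
      using X' by (intro induced_subgraph_cong[OF gT]) auto
    ultimately have g: "is_graph (induced_subgraph T {i. y \<in> X' i})" by simp
    show ?thesis
    proof (cases "y \<in> {u, w}")
      case True
      then have "j \<in> {i. y \<in> X' i}" "l \<in> {i. y \<in> X' i}" using j X' Xl by auto
      then show ?thesis
        using g j(1) l gT by (simp add: induced_add_leaf(1) is_graph_add_leaf)
    next
      case y: False
      with False have "l \<notin> {i. y \<in> X' i}" using Xl by simp
      then show ?thesis using g j l gT by (simp add: induced_add_leaf(2))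
    qed
  qed
  moreover have "(\<Union>i \<in> nodes ?T. X' i) = insert v V"
    using bagsD(1,3)[OF bags] X' Xl j by auto
  moreover have "\<exists>i \<in> nodes ?T. set_uprod e \<subseteq> X' i"
    if "e \<in> insert (Upair u v) (insert (Upair v w) E)" for e
  proof (cases "e \<in> E")
    case True
    then obtain i where "i \<in> nodes T" "set_uprod e \<subseteq> X i" by (rule bags_coverE[OF bags])
    then show ?thesis using X' by auto
  next
    case False
    then show ?thesis using that Xl by auto
  qed
  moreover have "finite (X' i) \<and> card (X' i) \<le> Suc k" if "i \<in> nodes ?T" for i
  proof (cases "i = l")
    case True
    have "card {u, v, w} \<le> 3" using card_length[of "[u, v, w]"] by simp
    with True Xl assms(4) show ?thesis by simp
  next
    case False
    with that X' show ?thesis using bagsD(4,5)[OF bags] by simp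
  qed
  ultimately have "bags k ?T X' (insert v V) (insert (Upair u v) (insert (Upair v w) E))"
    unfolding bags_def by blast
  moreover have "is_tree ?T" using T j l by (simp add: is_tree_add_leaf)
  ultimately show ?thesis by (auto simp: width_le_def)
qed

section \<open>Double ears in graphs of width two\<close>

lemma set_mset_cycle_edges: "set_mset (cycle_edges P) = insert (Upair (hd P) (last P)) (set_mset (path_edges P))"
  by (simp add: cycle_edges_def)

text \<open>The first node is attached to the edge that closes the cycle through the remaining
  nodes, and this edge is then dropped. If one node remains, that edge is a loop.\<close>

lemma width_le_cycle:
  assumes "vs \<noteq> []" "distinct vs" "k \<ge> 2"
  shows "width_le k (set vs) (set_mset (cycle_edges vs))"
  using assms(1,2)
proof (induction vs)
  case (Cons x vs)
  show ?case
  proof (cases "vs = []")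
    case True
    then show ?thesis by (auto intro!: width_le_single_bag simp: set_mset_cycle_edges)
  next
    case False
    then obtain y ys where vs: "vs = y # ys" by (cases vs) auto
    have "width_le k (insert x (set vs))
        (insert (Upair y x) (insert (Upair x (last vs)) (set_mset (cycle_edges vs))))"
      using Cons assms(3) vs by (intro width_le_attach) (auto simp: set_mset_cycle_edges)
    then show ?thesis
      unfolding list.simps by (rule width_le_mono) (auto simp: set_mset_cycle_edges vs)
  qed
qed simp

lemma width_le_insert_loop:
  assumes "width_le k V E" "x \<in> V"
  shows "width_le k V (insert (Upair x x) E)"
proof -
  obtain T X where T: "is_tree T" and bags: "bags k T X V E"
    using assms by (auto simp: width_le_def)
  have "\<exists>i \<in> nodes T. x \<in> X i" using bagsD(1)[OF bags] assms(2) by auto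
  with bags have "bags k T X V (insert (Upair x x) E)" by (simp add: bags_def)
  with T show ?thesis by (auto simp: width_le_def)
qed

text \<open>Suppressing the second node of \<open>P\<close> leaves a path with the same ends; that node is
  attached again to the edge between its neighbours afterwards.\<close>

lemma width_le_close_path:
  assumes "width_le k V E" "k \<ge> 2" "P \<noteq> []" "distinct P" "set P \<subseteq> V" "set_mset (path_edges P) \<subseteq> E"
    and "\<And>p e. p \<in> set P \<Longrightarrow> p \<noteq> hd P \<Longrightarrow> p \<noteq> last P \<Longrightarrow> e \<in> E \<Longrightarrow> p \<in> set_uprod e \<Longrightarrow> e \<in># path_edges P"
  shows "width_le k V (insert (Upair (hd P) (last P)) E)"
  using assms(1,3-)
proof (induction P arbitrary: V E rule: measure_induct_rule[of length])
  case (less P)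
  consider x where "P = [x]" | a b where "P = [a, b]" | a b c R' where "P = a # b # c # R'"
    using less.prems(2) by (metis neq_Nil_conv)
  then show ?case
  proof cases
    case 1
    then show ?thesis using less.prems width_le_insert_loop[of k V E x] by simp
  next
    case 2
    then show ?thesis using less.prems by (simp add: insert_absorb)
  next
    case 3
    define R where "R = c # R'"
    have P: "P = a # b # R" using 3 R_def by simp
    note prems = less.prems[unfolded P]
    let ?P = "a # b # R"
    have dist: "a \<noteq> b" "b \<noteq> last ?P" "b \<notin> set R"
      and last: "last ?P = last (a # R)"
      using prems(3) R_def by auto
    have pe: "set_mset (path_edges ?P) = {Upair a b, Upair b c} \<union> set_mset (path_edges R)"
      using R_def by auto
    then have E: "Upair a b \<in> E" "Upair b c \<in> E" "set_mset (path_edges R) \<subseteq> E"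
      using prems(5) by auto
    \<comment> \<open>All edges at the inner node \<open>b\<close> lie on the path, and distinctness
      leaves only these two. So attaching \<open>b\<close> again later restores everything that
      suppressing it removes.\<close>
    have b_edges: "e \<in> {Upair a b, Upair b c}" if e: "e \<in> E" "b \<in> set_uprod e" for e
    proof -
      have "e \<in># path_edges ?P" using prems(6)[of b e] e dist by simp
      moreover have "e \<notin># path_edges R" using path_edges_subset[of e R] e dist by auto
      ultimately show ?thesis unfolding pe by blast
    qed
    \<comment> \<open>The contraction of \<open>b\<close> into \<open>a\<close>, without the loop at
      \<open>a\<close> that the edge \<open>Upair a b\<close> turns into. The edge
      \<open>Upair a c\<close> shortens the path and is where \<open>b\<close> is attached
      again.\<close>
    define E' where "E' = insert (Upair a c) {e \<in> E. b \<notin> set_uprod e}"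
    have "width_le k (V - {b}) E'"
    proof (rule width_le_mono[OF width_le_contract[OF prems(1), of a b]])
      have "c \<noteq> b" using dist R_def by auto
      then show "E' \<subseteq> {e \<in> E. b \<notin> set_uprod e} \<union> {Upair a x |x. Upair b x \<in> E \<and> x \<noteq> b}"
        using E(2) by (auto simp: E'_def)
    qed (use E dist in auto)
    then have "width_le k (V - {b}) (insert (Upair (hd (a # R)) (last (a # R))) E')"
    proof (rule less.IH[rotated])
      show "distinct (a # R)" "set (a # R) \<subseteq> V - {b}" using prems(3,4) dist by auto
      have "b \<notin> set_uprod e" if "e \<in># path_edges R" for e
        using path_edges_subset[OF that] dist by auto
      then show "set_mset (path_edges (a # R)) \<subseteq> E'"
        using R_def E by (auto simp: E'_def)
    next
      fix p e
      assume p: "p \<in> set (a # R)" "p \<noteq> hd (a # R)" "p \<noteq> last (a # R)" "e \<in> E'" "p \<in> set_uprod e"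
      show "e \<in># path_edges (a # R)"
      proof (cases "e = Upair a c")
        case True
        then show ?thesis using R_def by simp
      next
        case False
        with p have "e \<in> E" "b \<notin> set_uprod e" by (auto simp: E'_def)
        moreover from this have "e \<in># path_edges ?P" using prems(6)[of p e] p last by simp
        ultimately have "e \<in># path_edges R" unfolding pe by auto
        then show ?thesis using R_def by simp
      qed
    qed (simp_all add: P)
    then have "width_le k (insert b (V - {b}))
        (insert (Upair a b) (insert (Upair b c) (insert (Upair (hd (a # R)) (last (a # R))) E')))"
      by (rule width_le_attach) (use assms(2) in \<open>auto simp: E'_def\<close>)
    moreover have "insert b (V - {b}) = V" using prems(4) by auto
    ultimately have "width_le k V
        (insert (Upair a b) (insert (Upair b c) (insert (Upair (hd (a # R)) (last (a # R))) E')))"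
      by simp
    then show ?thesis unfolding P
      by (rule width_le_mono) (use b_edges last in \<open>auto simp: E'_def\<close>)
  qed
qed

text \<open>The closing edge \<open>Upair (hd P) (last P)\<close> together with a second copy of each edge of \<open>P\<close> forms
  the ear to be removed.\<close>

definition ear_in :: "'a list \<Rightarrow> 'a uprod multiset \<Rightarrow> bool" where
  "ear_in P M \<longleftrightarrow> P \<noteq> [] \<and> distinct P \<and> path_edges P + cycle_edges P \<subseteq># M"

text \<open>Two multiplicities with sum four: one is at least three or both are two. It is applied
  to the four edges at a node with at most two neighbours.\<close>

lemma multiset_two_values:
  assumes "set_mset F \<subseteq> {a, b}" "size F = 4"
  shows "{#a, a, a#} \<subseteq># F \<or> {#b, b, b#} \<subseteq># F \<or> a \<noteq> b \<and> F = {#a, a, b, b#}"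
proof -
  have three: "{#x, x, x#} \<subseteq># F" if "count F x \<ge> 3" for x
    using that by (intro mset_subset_eqI) auto
  show ?thesis
  proof (cases "a = b")
    case True
    then have "F = replicate_mset (count F a) a"
      using assms(1) by (intro multiset_eqI) (auto simp: count_eq_zero_iff)
    then have "size F = count F a" by (metis size_replicate_mset)
    with assms(2) three[of a] show ?thesis by simp
  next
    case False
    then have F: "F = replicate_mset (count F a) a + replicate_mset (count F b) b"
      using assms(1) by (intro multiset_eqI) (auto simp: count_eq_zero_iff)
    then have "size F = count F a + count F b" by (metis size_replicate_mset size_union)
    with assms(2) consider "count F a \<ge> 3" | "count F b \<ge> 3" | "count F a = 2" "count F b = 2"
      by linarith
    then show ?thesis
    proof cases
      case 3
      have "F = {#a, a, b, b#}"
        by (subst F) (simp add: 3 numeral_2_eq_2)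
      with False show ?thesis by blast
    qed (use three in blast)+
  qed
qed

text \<open>Stated for a node set and an edge multiset, so that the reduction only has to keep
  degrees and width. A loop is an ear on one node and a triple edge an ear on two. Otherwise an ear
  of the reduced multigraph uses the new edge \<open>uw\<close> inside its path, only as closing
  edge, or not at all, and each case lifts to \<open>M\<close>.\<close>

lemma ex_ear:
  assumes "finite V" "V \<noteq> {}" "\<And>e. e \<in># M \<Longrightarrow> set_uprod e \<subseteq> V"
    and "\<And>v. v \<in> V \<Longrightarrow> incidence M v = 4" "width_le 2 V (set_mset M)"
  shows "\<exists>P. ear_in P M"
  using assms
proof (induction "card V" arbitrary: V M rule: less_induct)
  case less
  show ?case
  proof (cases "\<exists>v. Upair v v \<in># M")
    case True
    then obtain v where "Upair v v \<in># M" by blast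
    then have "ear_in [v] M" by (simp add: ear_in_def cycle_edges_def)
    then show ?thesis by blast
  next
    case False
    obtain v where v: "v \<in> V" "finite {u. u \<noteq> v \<and> Upair v u \<in># M}" "card {u. u \<noteq> v \<and> Upair v u \<in># M} \<le> 2"
      using width_le_ex_low_degree[OF less.prems(5,2)] by blast
    let ?S = "{u. u \<noteq> v \<and> Upair v u \<in># M}"
    obtain u where u: "u \<in> ?S"
    proof -
      have "incidence M v > 0" using less.prems(4)[OF v(1)] by simp
      then obtain x N where "M = add_mset (Upair v x) N" by (rule incidence_pos)
      with False that show thesis by auto
    qed
    \<comment> \<open>If \<open>u\<close> is the only neighbour of \<open>v\<close>, then
      \<open>w = u\<close>.\<close>
    obtain w where w: "w \<in> ?S" "?S \<subseteq> {u, w}"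
    proof (cases "?S - {u} = {}")
      case True
      then show thesis using that[of u] u by blast
    next
      case False
      then obtain w where w: "w \<in> ?S - {u}" by blast
      have "finite (?S - {u})" "card (?S - {u}) \<le> Suc 0"
        using v(2,3) card_Diff_singleton[OF u] by auto
      then have "\<forall>x \<in> ?S - {u}. \<forall>y \<in> ?S - {u}. x = y"
        by (simp only: card_le_Suc0_iff_eq)
      with w have "?S \<subseteq> {u, w}" by blast
      with w that show thesis by blast
    qed
    have uw: "?S \<subseteq> {u, w}" "u \<noteq> v" "w \<noteq> v" using u w by auto
    define N where "N = {# e \<in># M. v \<notin> set_uprod e #}"
    define F where "F = {# e \<in># M. v \<in> set_uprod e #}"
    have M: "M = N + F" unfolding N_def F_def by (metis multiset_partition add.commute)
    have nbr: "x = u \<or> x = w" if "Upair v x \<in># M" for x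
      using that uw(1) False by auto
    have "set_mset F \<subseteq> {Upair v u, Upair v w}"
      using nbr by (auto simp: F_def elim!: edge_at)
    moreover have "size F = 4"
      using less.prems(4)[OF v(1)] False by (simp add: incidence_def F_def not_in_iff)
    ultimately have "{#Upair v u, Upair v u, Upair v u#} \<subseteq># F \<or>
        {#Upair v w, Upair v w, Upair v w#} \<subseteq># F \<or>
        Upair v u \<noteq> Upair v w \<and> F = {#Upair v u, Upair v u, Upair v w, Upair v w#}"
      by (rule multiset_two_values)
    then consider "{#Upair v u, Upair v u, Upair v u#} \<subseteq># F"
      | "{#Upair v w, Upair v w, Upair v w#} \<subseteq># F"
      | "Upair v u \<noteq> Upair v w" "F = {#Upair v u, Upair v u, Upair v w, Upair v w#}"
      by argo
    then show ?thesis
    proof cases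
      case 1
      then have "ear_in [v, u] M" using M uw by (auto simp: ear_in_def cycle_edges_def intro: subset_mset.order_trans)
      then show ?thesis by blast
    next
      case 2
      then have "ear_in [v, w] M" using M uw by (auto simp: ear_in_def cycle_edges_def intro: subset_mset.order_trans)
      then show ?thesis by blast
    next
      case 3
      let ?c = "Upair u w"
      \<comment> \<open>Two copies, so that \<open>u\<close> and \<open>w\<close> get back the two
        edges each that they lose with \<open>v\<close>, and all degrees stay four.\<close>
      define H where "H = N + {#?c, ?c#}"
      have "u \<noteq> w" using 3(1) by auto
      have uM: "Upair v u \<in># M" "Upair v w \<in># M" using M 3(2) by auto
      then have uV: "u \<in> V - {v}" "w \<in> V - {v}" using less.prems(3) uw by fastforce+
      have "width_le 2 (V - {v}) (set_mset H)"
      proof (rule width_le_mono[OF width_le_contract[OF less.prems(5), of u v]])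
        show "Upair u v \<in># M" using uM(1) by (metis Upair_inject)
        show "set_mset H \<subseteq> {e \<in> set_mset M. v \<notin> set_uprod e}
            \<union> {Upair u x |x. Upair v x \<in># M \<and> x \<noteq> v}"
          using uM uw by (auto simp: H_def N_def)
      qed (use uw in simp)
      moreover have "incidence H x = 4" if "x \<in> V - {v}" for x
        using less.prems(4)[of x] that 3(2) unfolding M H_def by simp
      moreover have "set_uprod e \<subseteq> V - {v}" if "e \<in># H" for e
        using that less.prems(3)[of e] uV by (auto simp: H_def N_def)
      moreover have "card (V - {v}) < card V"
        using less.prems(1) v(1) by (rule card_Diff1_less)
      ultimately obtain P where "ear_in P H"
        using less.hyps[of "V - {v}" H] less.prems(1) uV by auto
      then have P: "P \<noteq> []" "distinct P" and sub: "path_edges P + cycle_edges P \<subseteq># H"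
        by (auto simp: ear_in_def)
      \<comment> \<open>No edge of \<open>H\<close> meets \<open>v\<close>, whereas every node of an
        ear has degree at least two.\<close>
      have vP: "v \<notin> set P"
      proof
        assume "v \<in> set P"
        then have "incidence (path_edges P + cycle_edges P) v \<ge> 2"
          using incidence_cycle_edges[OF P] by simp
        moreover have "incidence H v = 0"
          using uw by (auto simp: incidence_eq_0_iff H_def N_def)
        ultimately show False using incidence_mono[OF sub, of v] by simp
      qed
      show ?thesis
      proof (cases "?c \<in># path_edges P")
        case True
        then obtain xs p q ys where P_eq: "P = xs @ p # q # ys" and pq: "?c = Upair p q"
          by (rule path_edges_memE)
        \<comment> \<open>The ear contains the path edge \<open>uw\<close> twice. Routing both
          copies through \<open>v\<close> consumes exactly the four edges in
          \<open>F\<close>.\<close>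
        let ?P' = "xs @ p # v # q # ys"
        have Pe: "path_edges P = add_mset ?c (path_edges (xs @ [p]) + path_edges (q # ys))"
          unfolding P_eq pq path_edges_split[of xs p "q # ys"] by simp
        \<comment> \<open>The path may traverse the edge in either direction, so \<open>p\<close>,
          \<open>q\<close> are \<open>u\<close>, \<open>w\<close> in some order.\<close>
        have ab: "{#Upair p v, Upair v q#} = {#Upair v u, Upair v w#}"
          using pq by (auto simp: add_mset_commute)
        have P'e: "path_edges ?P' = path_edges (xs @ [p]) + path_edges (q # ys) + {#Upair v u, Upair v w#}"
          unfolding path_edges_split[of xs p "v # q # ys"] ab[symmetric] by simp
        have "hd ?P' = hd P" "last ?P' = last P" unfolding P_eq by (cases xs; simp)+
        then have "path_edges ?P' + cycle_edges ?P' \<subseteq># M"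
          using sub unfolding cycle_edges_def P'e Pe H_def M 3(2)
          by (simp add: add_mset_commute)
        moreover have "distinct ?P'" using P vP P_eq by auto
        ultimately have "ear_in ?P' M" by (simp add: ear_in_def)
        then show ?thesis by blast
      next
        case False
        show ?thesis
        proof (cases "Upair (hd P) (last P) = ?c")
          case False': False
          have "path_edges P + cycle_edges P \<subseteq># N"
            by (rule subset_mset_union_disjoint[OF sub[unfolded H_def]])
              (use False False' in \<open>auto simp: cycle_edges_def\<close>)
          then have "ear_in P M" using P M
            by (auto simp: ear_in_def intro: subset_mset.order_trans)
          then show ?thesis by blast
        next
          case True
          \<comment> \<open>The closing edge is \<open>uw\<close>, so the ends of \<open>P\<close>
            are the neighbours of \<open>v\<close>. Appending \<open>v\<close> needs the edge from
            \<open>last P\<close> to \<open>v\<close> twice and the edge from \<open>hd P\<close> to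
            \<open>v\<close> once as the new closing edge: three of the four edges in
            \<open>F\<close>.\<close>
          let ?P' = "P @ [v]"
          have "path_edges P + path_edges P \<subseteq># N + {#?c, ?c#}"
            by (rule subset_mset.order_trans[OF _ sub[unfolded H_def]]) (simp add: cycle_edges_def)
          then have "path_edges P + path_edges P \<subseteq># N"
            by (rule subset_mset_union_disjoint) (use False in auto)
          moreover have "{#Upair (last P) v, Upair (last P) v, Upair (hd P) v#} \<subseteq># F"
            using True unfolding 3(2) by (auto intro!: mset_subset_eqI)
          ultimately have "(path_edges P + path_edges P) +
              {#Upair (last P) v, Upair (last P) v, Upair (hd P) v#} \<subseteq># M"
            unfolding M by (rule subset_mset.add_mono)
          then have "path_edges ?P' + cycle_edges ?P' \<subseteq># M"
            using P(1) by (simp add: cycle_edges_def path_edges_snoc add_mset_commute)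
          then have "ear_in ?P' M" using P vP by (simp add: ear_in_def)
          then show ?thesis by blast
        qed
      qed
    qed
  qed
qed

section \<open>Double ear decompositions\<close>

lemma double_ear_decomposable_cycle:
  assumes "is_graph C" "is_cycle C"
  shows "double_ear_decomposable C"
proof -
  have "double_ear_decomposition [C] C C"
    using assms(1) by (simp add: double_ear_decomposition_def)
  with assms(2) show ?thesis unfolding double_ear_decomposable_def by blast
qed

lemma double_ear_decomposable_step:
  assumes "double_ear_decomposable H" "double_ear_step H G \<or> simple_subdivision H G" "is_graph G"
  shows "double_ear_decomposable G"
proof -
  obtain Gs G0 where "is_cycle G0" "double_ear_decomposition Gs G0 H"
    using assms(1) unfolding double_ear_decomposable_def by blast
  moreover from this have "double_ear_decomposition (Gs @ [G]) G0 G"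
    using assms(2,3) by (auto simp: double_ear_decomposition_def successively_append_iff)
  ultimately show ?thesis unfolding double_ear_decomposable_def by blast
qed

lemma double_ear_decomposable_induct [consumes 1, case_names cycle step]:
  assumes "double_ear_decomposable G"
    and cyc: "\<And>C. is_graph C \<Longrightarrow> is_cycle C \<Longrightarrow> P C"
    and step: "\<And>H G. is_graph H \<Longrightarrow> is_graph G \<Longrightarrow> P H \<Longrightarrow>
      double_ear_step H G \<or> simple_subdivision H G \<Longrightarrow> P G"
  shows "P G"
proof -
  obtain Gs G0 where "is_cycle G0" and Gs: "double_ear_decomposition Gs G0 G"
    using assms(1) unfolding double_ear_decomposable_def by blast
  have "Gs \<noteq> []" using Gs by (simp add: double_ear_decomposition_def)
  then have "double_ear_decomposition Gs G0 G \<Longrightarrow> P G"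
  proof (induction Gs arbitrary: G rule: rev_nonempty_induct)
    case (single K)
    then show ?case using \<open>is_cycle G0\<close> cyc by (auto simp: double_ear_decomposition_def)
  next
    case (snoc K Ks)
    then have "double_ear_decomposition Ks G0 (last Ks)" "K = G"
      and "double_ear_step (last Ks) K \<or> simple_subdivision (last Ks) K" "is_graph (last Ks)" "is_graph K"
      by (auto simp: double_ear_decomposition_def successively_append_iff)
    with snoc.IH step show ?case by blast
  qed
  with Gs show ?thesis by blast
qed

text \<open>The closing edge and the second copy of the path together form a cycle through the nodes
  of \<open>P\<close>; hence the degree rises by exactly two on a path and nowhere else.\<close>

lemma add_double_ear_eq: "add_double_ear G P = \<lparr>nodes = nodes G, edges = edges G + cycle_edges P\<rparr>"
  by (simp add: add_double_ear_def cycle_edges_def)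

lemma double_ear_decomposable_imp:
  assumes "double_ear_decomposable G"
  shows "width_le 2 (nodes G) (set_mset (edges G)) \<and> (\<forall>v \<in> nodes G. incidence (edges G) v \<in> {2, 4})"
  using assms
proof (induction rule: double_ear_decomposable_induct)
  case (cycle C)
  then obtain vs where "vs \<noteq> []" "distinct vs" "nodes C = set vs" "edges C = cycle_edges vs"
    by (auto simp: is_cycle_iff)
  then show ?case by (simp add: width_le_cycle incidence_cycle_edges)
next
  case (step H G)
  from \<open>double_ear_step H G \<or> simple_subdivision H G\<close> show ?case
  proof
    assume "double_ear_step H G"
    then obtain P where P: "is_path H P" "\<And>v. v \<in> set P \<Longrightarrow> incidence (edges H) v = 2"
      and G: "G = add_double_ear H P"
      by (auto simp: double_ear_step_def degree_eq_incidence)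
    from P(1) have P': "P \<noteq> []" "distinct P" "set P \<subseteq> nodes H" and sub: "path_edges P \<subseteq># edges H"
      by (auto simp: is_path_def)
    have "width_le 2 (nodes H) (insert (Upair (hd P) (last P)) (set_mset (edges H)))"
    proof (rule width_le_close_path)
      fix p e assume p: "p \<in> set P" "p \<noteq> hd P" "p \<noteq> last P" and e: "e \<in># edges H" "p \<in> set_uprod e"
      \<comment> \<open>The two path edges at an inner node exhaust its degree two, so every edge
        there lies on the path, as closing the path requires.\<close>
      have "count (mset P) p > 0" using p(1) by simp
      then have "incidence (path_edges P) p \<ge> 2"
        using incidence_path_edges[OF P'(1), of p] p(2,3) by simp
      then have "incidence (edges H - path_edges P) p = 0"
        using incidence_diff[OF sub, of p] P(2)[OF p(1)] by simp
      then have "e \<notin># edges H - path_edges P"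
        using e(2) by (auto simp: incidence_eq_0_iff)
      then show "e \<in># path_edges P"
        using e(1) subset_mset.diff_add[OF sub] by (metis union_iff)
    qed (use step P' set_mset_mono[OF sub] in auto)
    \<comment> \<open>As a set of edges the ear contributes only its closing edge; the duplicates do
      not affect width.\<close>
    moreover have "set_mset (edges G) = insert (Upair (hd P) (last P)) (set_mset (edges H))"
      using set_mset_mono[OF sub] by (auto simp: G add_double_ear_eq set_mset_cycle_edges)
    moreover have "incidence (edges G) v \<in> {2, 4}" if "v \<in> nodes H" for v
      using step that P(2)[of v] by (auto simp: G add_double_ear_eq incidence_cycle_edges[OF P'(1,2)])
    ultimately show ?thesis by (simp add: G add_double_ear_eq)
  next
    assume "simple_subdivision H G"
    then obtain u w v where uw: "Upair u w \<in># edges H" and v: "v \<notin> nodes H"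
      and G: "G = \<lparr>nodes = insert v (nodes H), edges = edges H - {# Upair u w #} + {# Upair u v, Upair v w #}\<rparr>"
      unfolding simple_subdivision_def by blast
    obtain N where N: "edges H = add_mset (Upair u w) N" using uw by (blast dest: multi_member_split)
    have G': "nodes G = insert v (nodes H)" "edges G = add_mset (Upair u v) (add_mset (Upair v w) N)"
      by (simp_all add: G N)
    have "width_le 2 (insert v (nodes H))
        (insert (Upair u v) (insert (Upair v w) (set_mset (edges H))))"
      using step uw v by (intro width_le_attach) auto
    then have "width_le 2 (nodes G) (set_mset (edges G))"
      unfolding G' by (rule width_le_mono) (auto simp: N)
    moreover have "incidence (edges G) x \<in> {2, 4}" if "x \<in> nodes G" for x
    proof (cases "x = v")
      case True
      have "incidence (edges H) v = 0" using not_incident step v by metis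
      then show ?thesis using True by (auto simp: G' N split: if_splits)
    next
      case False
      with that have "incidence (edges H) x \<in> {2, 4}" using step by (simp add: G')
      moreover have "incidence (edges G) x = incidence (edges H) x" using False by (simp add: G' N)
      ultimately show ?thesis by simp
    qed
    ultimately show ?thesis by blast
  qed
qed

section \<open>Undoing the two kinds of step, and sufficiency of the conditions\<close>

text \<open>An ear holds every path edge twice and \<open>cycle_edges P\<close> takes away one copy,
  so \<open>P\<close> survives and a walk along it replaces the closing edge.\<close>

lemma is_graph_remove_ear:
  assumes G: "is_graph G" and P: "ear_in P (edges G)"
  shows "is_graph \<lparr>nodes = nodes G, edges = edges G - cycle_edges P\<rparr>" (is "is_graph ?H")
    and "is_path \<lparr>nodes = nodes G, edges = edges G - cycle_edges P\<rparr> P"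
proof -
  from P have P': "P \<noteq> []" "distinct P" and sub: "path_edges P + cycle_edges P \<subseteq># edges G"
    by (auto simp: ear_in_def)
  have cyc: "cycle_edges P \<subseteq># edges G"
    by (rule subset_mset.order_trans[OF _ sub]) simp
  have "path_edges P \<subseteq># edges G - cycle_edges P"
  proof (rule mset_subset_eqI)
    fix e show "count (path_edges P) e \<le> count (edges G - cycle_edges P) e"
      using mset_subset_eq_count[OF sub, of e] by simp
  qed
  then have pe: "path_edges P \<subseteq># edges ?H" by simp
  \<comment> \<open>\<open>ear_in\<close> speaks of edges only. The nodes of \<open>P\<close> belong
    to \<open>G\<close> because they have positive degree; for a single node this comes from the
    loop.\<close>
  have "set P \<subseteq> nodes G"
  proof
    fix p assume "p \<in> set P"
    then have "incidence (edges G) p \<ge> 2"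
      using incidence_mono[OF cyc, of p] incidence_cycle_edges[OF P', of p] by simp
    then show "p \<in> nodes G" using not_incident[OF G, of p] by fastforce
  qed
  with P' pe show "is_path ?H P" by (simp add: is_path_def)
  have reach: "(adjacent ?H)\<^sup>*\<^sup>* (hd P) (last P)"
    using reachable_path_edges[OF pe P'(1)] .
  show "is_graph ?H"
  proof (rule is_graph_image[OF G, where f = "\<lambda>x. x"])
    fix x y assume "adjacent G x y"
    then have "Upair x y \<in># edges G" by (simp add: adjacent_def)
    then have "Upair x y \<in># (edges G - cycle_edges P) + cycle_edges P"
      using cyc by simp
    then have "Upair x y \<in># edges ?H \<or> Upair x y \<in># cycle_edges P"
      by simp
    then consider "Upair x y \<in># edges ?H" | "Upair x y = Upair (hd P) (last P)"
      using set_mset_mono[OF pe] by (auto simp: set_mset_cycle_edges)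
    then show "(adjacent ?H)\<^sup>*\<^sup>* x y"
    proof cases
      case 1
      then show ?thesis by (auto simp: adjacent_def)
    next
      case 2
      then show ?thesis using reach reachable_commute[OF reach] by auto
    qed
  next
    show "set_uprod e \<subseteq> nodes ?H" if "e \<in># edges ?H" for e
      using G that by (auto simp: is_graph_def dest: in_diffD)
  qed (use G in \<open>auto simp: is_graph_def\<close>)
qed

text \<open>On the graph side this contracts the edge \<open>vu\<close> into \<open>u\<close>. The
  case \<open>u = w\<close> is included: two parallel edges become a loop at \<open>u\<close>, which
  keeps degree two from them.\<close>

lemma suppress_node:
  assumes G: "is_graph G" and v: "v \<in> nodes G" "Upair v v \<notin># edges G"
    and edges: "edges G = add_mset (Upair v u) (add_mset (Upair v w) N)" and N: "incidence N v = 0"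
  defines "H \<equiv> \<lparr>nodes = nodes G - {v}, edges = add_mset (Upair u w) N\<rparr>"
  shows "is_graph H" and "simple_subdivision H G"
    and "width_le k (nodes G) (set_mset (edges G)) \<Longrightarrow> width_le k (nodes H) (set_mset (edges H))"
    and "x \<in> nodes H \<Longrightarrow> incidence (edges H) x = incidence (edges G) x"
proof -
  have uw: "u \<in> nodes G" "w \<in> nodes G" "u \<noteq> v" "w \<noteq> v"
    using is_graph_edges[OF G, of v u] is_graph_edges[OF G, of v w] v(2) by (auto simp: edges)
  have N': "v \<notin> set_uprod e" if "e \<in># N" for e using N that by (simp add: incidence_eq_0_iff)
  show "is_graph H"
  proof (rule is_graph_image[OF G, where f = "\<lambda>x. if x = v then u else x"])
    fix e assume e: "e \<in># edges H"
    show "set_uprod e \<subseteq> nodes H"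
    proof (cases "e \<in># N")
      case True
      then have "set_uprod e \<subseteq> nodes G" using G by (simp add: is_graph_def edges)
      with N'[OF True] show ?thesis by (auto simp: H_def)
    next
      case False
      with e uw show ?thesis by (simp add: H_def)
    qed
  next
    fix x y assume "adjacent G x y"
    then consider "Upair x y = Upair v u" | "Upair x y = Upair v w" | "Upair x y \<in># N"
      by (auto simp: adjacent_def edges)
    then show "(adjacent H)\<^sup>*\<^sup>* (if x = v then u else x) (if y = v then u else y)"
    proof cases
      case 2
      have "adjacent H u w" by (simp add: adjacent_def H_def)
      moreover from this have "adjacent H w u" by (simp add: adjacent_commute)
      ultimately show ?thesis using 2 uw by auto
    next
      case 3
      then have "x \<noteq> v" "y \<noteq> v" using N'[OF 3] by auto
      with 3 show ?thesis by (auto simp: H_def adjacent_def)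
    qed auto
  qed (use G uw in \<open>auto simp: is_graph_def H_def\<close>)
  have "Upair v u = Upair u v" by simp
  then show "simple_subdivision H G"
    unfolding simple_subdivision_def using v(1)
    by (intro exI[of _ u] exI[of _ w] exI[of _ v]) (auto simp: H_def edges insert_absorb)
  show "width_le k (nodes H) (set_mset (edges H))" if "width_le k (nodes G) (set_mset (edges G))"
  proof -
    have "Upair u v \<in># edges G" by (simp add: edges)
    from width_le_contract[OF that this uw(3)] show ?thesis
      unfolding H_def select_convs
      by (rule width_le_mono) (use N' uw in \<open>auto simp: edges\<close>)
  qed
  show "incidence (edges H) x = incidence (edges G) x" if "x \<in> nodes H"
    using that by (auto simp: H_def edges)
qed

text \<open>The loop uses up the whole degree of \<open>v\<close>, so no edge leaves
  \<open>v\<close>, and connectivity leaves no other node: the graph is the cycle of length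
  one.\<close>

lemma is_cycle_loop:
  assumes G: "is_graph G" and v: "v \<in> nodes G" "Upair v v \<in># edges G" "incidence (edges G) v = 2"
  shows "is_cycle G"
proof -
  obtain N where N: "edges G = add_mset (Upair v v) N" using v(2) by (blast dest: multi_member_split)
  have N0: "incidence N v = 0" using v(3) by (simp add: N)
  have "nodes G = {v}"
  proof (rule ccontr)
    assume "nodes G \<noteq> {v}"
    then obtain y where y: "y \<noteq> v" "adjacent G v y" using is_graph_ex_adjacent[OF G v(1)] by blast
    then have "Upair v y \<in># N" by (auto simp: adjacent_def N)
    with N0 show False by (auto simp: incidence_eq_0_iff)
  qed
  moreover have "N = {#}"
  proof (rule ccontr)
    assume "N \<noteq> {#}"
    then obtain e where "e \<in># N" by blast
    moreover from this have "set_uprod e \<subseteq> {v}"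
      using G \<open>nodes G = {v}\<close> by (simp add: is_graph_def N)
    moreover have "set_uprod e \<noteq> {}" by (cases e) auto
    ultimately show False using N0 by (auto simp: incidence_eq_0_iff)
  qed
  ultimately show ?thesis
    unfolding is_cycle_iff by (intro exI[of _ "[v]"]) (simp add: N cycle_edges_def)
qed

text \<open>The induction is on the number of edges, because removing an ear keeps all nodes.
  Suppression preserves the other degrees; removing an ear lowers the degrees on its path from four
  to two, just what adding it back demands. The recursion always ends in a single node with one
  loop.\<close>

lemma double_ear_decomposableI:
  assumes "is_graph G" "width_le 2 (nodes G) (set_mset (edges G))"
    and "\<And>v. v \<in> nodes G \<Longrightarrow> incidence (edges G) v \<in> {2, 4}"
  shows "double_ear_decomposable G"
  using assms
proof (induction "size (edges G)" arbitrary: G rule: less_induct)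
  case less
  note G = less.prems(1)
  show ?case
  proof (cases "\<exists>v \<in> nodes G. incidence (edges G) v = 2")
    case True
    then obtain v where v: "v \<in> nodes G" "incidence (edges G) v = 2" by blast
    show ?thesis
    proof (cases "Upair v v \<in># edges G")
      case True
      with G v show ?thesis by (intro double_ear_decomposable_cycle is_cycle_loop)
    next
      case False
      obtain u M where M: "edges G = add_mset (Upair v u) M"
        using v(2) by (metis incidence_pos zero_less_numeral)
      then have "u \<noteq> v" using False by auto
      then have "incidence M v = 1" using v(2) M by simp
      then obtain w N where N: "M = add_mset (Upair v w) N"
        by (metis incidence_pos zero_less_one)
      then have "w \<noteq> v" using False M by auto
      then have "incidence N v = 0" using \<open>incidence M v = 1\<close> N by simp
      note H = suppress_node[OF G v(1) False M[unfolded N] this]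
      let ?H = "\<lparr>nodes = nodes G - {v}, edges = add_mset (Upair u w) N\<rparr>"
      have "double_ear_decomposable ?H"
      proof (rule less.hyps)
        show "size (edges ?H) < size (edges G)" by (simp add: M N)
        show "incidence (edges ?H) x \<in> {2, 4}" if "x \<in> nodes ?H" for x
          using less.prems(3)[of x] that H(4)[OF that] by simp
      qed (use H less.prems(2) in auto)
      then show ?thesis using H(2) G by (blast intro: double_ear_decomposable_step)
    qed
  next
    case False
    with less.prems(3) have four: "\<And>v. v \<in> nodes G \<Longrightarrow> incidence (edges G) v = 4" by blast
    have "\<exists>P. ear_in P (edges G)"
      using G less.prems(2) four by (intro ex_ear[of "nodes G"]) (auto simp: is_graph_def)
    then obtain P where P: "ear_in P (edges G)" by blast
    then have P': "P \<noteq> []" "distinct P" and "path_edges P + cycle_edges P \<subseteq># edges G"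
      by (auto simp: ear_in_def)
    from this(3) have sub: "cycle_edges P \<subseteq># edges G"
      by (rule subset_mset.order_trans[rotated]) simp
    let ?H = "\<lparr>nodes = nodes G, edges = edges G - cycle_edges P\<rparr>"
    note H = is_graph_remove_ear[OF G P]
    have inc: "incidence (edges ?H) v = (if v \<in> set P then 2 else 4)" if "v \<in> nodes G" for v
      using four[OF that] incidence_diff[OF sub, of v] incidence_cycle_edges[OF P'] by simp
    have "double_ear_decomposable ?H"
    proof (rule less.hyps)
      have "size (cycle_edges P) > 0" by (simp add: cycle_edges_def)
      moreover have "size (cycle_edges P) \<le> size (edges G)" using sub by (rule size_mset_mono)
      ultimately show "size (edges ?H) < size (edges G)" using size_Diff_submset[OF sub] by simp
      show "width_le 2 (nodes ?H) (set_mset (edges ?H))"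
        using width_le_mono[OF less.prems(2)] by (auto dest: in_diffD)
    qed (use H(1) inc in auto)
    moreover have "double_ear_step ?H G"
    proof -
      have "degree ?H v = 2" if "v \<in> set P" for v
        using inc[of v] that H(2) by (auto simp: degree_eq_incidence is_path_def)
      moreover have "G = add_double_ear ?H P"
        using sub by (simp add: add_double_ear_eq)
      ultimately show ?thesis using H(2) unfolding double_ear_step_def by blast
    qed
    ultimately show ?thesis using G by (blast intro: double_ear_decomposable_step)
  qed
qed

theorem theorem11:
  fixes G :: "'a mgraph"
  assumes "is_graph G"
  shows "double_ear_decomposable G \<longleftrightarrow>
           treewidth G \<le> 2 \<and> (\<forall>v \<in> nodes G. degree G v \<in> {2, 4})"
  unfolding treewidth_le_iff[OF assms] degree_eq_incidence
  using double_ear_decomposable_imp[of G] double_ear_decomposableI[OF assms] by blast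

end
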